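(* Let $R\subset\mathbb{S}^2$ be the set of regular shapes in the shape sphere of labelled planar triangles (a union of great circles), equipped with the probability measure given by normalized arc length. Then $$\mathrm{Prob}(\text{Acute}\mid\text{Regular}) = \frac{2}{\pi}\arcsin\frac{1}{\sqrt{3}} \quad(\approx 0.3918),$$ and, complementarily, $$\mathrm{Prob}(\text{Obtuse}\mid\text{Regular}) = \frac{\pi - 2\arcsin\frac{1}{\sqrt3}}{\pi}\quad(\approx 0.6082).$$
   Context: A labelled triangle is an ordered triple $(q_1,q_2,q_3)$ of points of $\mathbb{R}^2$, not all three equal. Its shape is its equivalence class under translations, rotations and positive dilations (vertices are labelled; mirror images are not identified). Relative Jacobi coordinates: $R_1 = q_3 - q_2$ and $R_2 = q_1 - \tfrac12(q_2+q_3)$. Mass-weighted relative Jacobi coordinates: $\vec\rho_1 = \sqrt{1/2}\,R_1$ and $\vec\rho_2 = \sqrt{2/3}\,R_2$, with magnitudes $\rho_1,\rho_2$. The shape sphere is the unit sphere $\mathbb{S}^2\subset\mathbb{R}^3$ with its standard round metric. Shapes are identified with its points by the bijection sending the shape of $(q_1,q_2,q_3)$ to $$(X,Y,Z) = \frac{\left(2\,\vec\rho_1\cdot\vec\rho_2,\; 2(\vec\rho_1\times\vec\rho_2)_3,\; \rho_1^2-\rho_2^2\right)}{\rho_1^2+\rho_2^2},$$ where $(\vec a\times\vec b)_3 = a_1b_2-a_2b_1$. A cluster labelling is a choice of apex vertex; the base is the opposite side and the median is the segment from the midpoint of the base to the apex. For apex $q_1$, the partial moments of inertia of the base and of the median are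 $\rho_1^2$ and $\rho_2^2$ respectively; for the other apexes they are defined by the same formulas after permuting vertices cyclically. A shape is regular with respect to a cluster labelling if the two partial moments of inertia are equal, equivalently the median has length $\sqrt3/2$ times that of the base (for apex $q_1$: the great circle $Z=0$). $R$ is the union of the three great circles so obtained for the three cluster labellings. Normalized arc length on $R$ means arc length divided by the total length of $R$. $\mathrm{Prob}(P\mid\text{Regular})$ is the normalized arc length of the set of shapes in $R$ with property $P$. A non-collinear triangle is obtuse if one of its interior angles is strictly greater than $\pi/2$, and acute if all its interior angles are strictly less than $\pi/2$. Collinear and right-angled shapes are finitely many on $R$, hence negligible. *)

theory Defs
  imports "HOL-Analysis.Analysis"
begin

section \<open>Labelled triangles and their shapes\<close>

type_synonym triangle = "(real^2) \<times> (real^2) \<times> (real^2)"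

definition labelled_triangles :: "triangle set" where
  "labelled_triangles = {(q1, q2, q3). \<not> (q1 = q2 \<and> q2 = q3)}"

definition same_shape :: "(triangle \<times> triangle) set" where
  "same_shape = {((q1, q2, q3), (p1, p2, p3)).
     (q1, q2, q3) \<in> labelled_triangles \<and> (p1, p2, p3) \<in> labelled_triangles \<and>
     (\<exists>(c::real) (A::real^2^2) (t::real^2). c > 0 \<and> rotation_matrix A \<and>
        p1 = c *\<^sub>R (A *v q1) + t \<and>
        p2 = c *\<^sub>R (A *v q2) + t \<and>
        p3 = c *\<^sub>R (A *v q3) + t)}"

definition shapes :: "triangle set set" where
  "shapes = labelled_triangles // same_shape"

section \<open>Jacobi coordinates and the shape sphere\<close>

fun jacobi1 :: "triangle \<Rightarrow> real^2" where
  "jacobi1 (q1, q2, q3) = q3 - q2"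

fun jacobi2 :: "triangle \<Rightarrow> real^2" where
  "jacobi2 (q1, q2, q3) = q1 - (1/2) *\<^sub>R (q2 + q3)"

definition rho1 :: "triangle \<Rightarrow> real^2" where
  "rho1 q = sqrt (1/2) *\<^sub>R jacobi1 q"

definition rho2 :: "triangle \<Rightarrow> real^2" where
  "rho2 q = sqrt (2/3) *\<^sub>R jacobi2 q"

definition cross2 :: "real^2 \<Rightarrow> real^2 \<Rightarrow> real" where
  "cross2 a b = a$1 * b$2 - a$2 * b$1"

definition hopf_point :: "triangle \<Rightarrow> real^3" where
  "hopf_point q = (1 / ((norm (rho1 q))\<^sup>2 + (norm (rho2 q))\<^sup>2)) *\<^sub>R
     vector [2 * (rho1 q \<bullet> rho2 q),
             2 * cross2 (rho1 q) (rho2 q),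
             (norm (rho1 q))\<^sup>2 - (norm (rho2 q))\<^sup>2]"

text \<open>\<^const>\<open>hopf_point\<close> is constant on shapes, so the image below is a singleton.\<close>

definition sphere_point :: "triangle set \<Rightarrow> real^3" where
  "sphere_point s = the_elem (hopf_point ` s)"

text \<open>To be used for similarity-invariant properties, for which it does not matter
  whether one or every representative of the shape is required to satisfy \<open>P\<close>.\<close>

definition shapes_with :: "(triangle \<Rightarrow> bool) \<Rightarrow> (real^3) set" where
  "shapes_with P = sphere_point ` {s \<in> shapes. \<exists>q\<in>s. P q}"

section \<open>Regular shapes\<close>

definition base_moment :: "triangle \<Rightarrow> real" where
  "base_moment q = (norm (rho1 q))\<^sup>2"

definition median_moment :: "triangle \<Rightarrow> real" where
  "median_moment q = (norm (rho2 q))\<^sup>2"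

fun cyclic_perm :: "triangle \<Rightarrow> triangle" where
  "cyclic_perm (q1, q2, q3) = (q2, q3, q1)"

text \<open>The cluster labellings are numbered 0, 1, 2; number \<open>k\<close> has apex
  \<open>q\<close> with index \<open>k + 1\<close>.\<close>

definition regular_wrt :: "nat \<Rightarrow> triangle \<Rightarrow> bool" where
  "regular_wrt k q \<longleftrightarrow>
     base_moment ((cyclic_perm ^^ k) q) = median_moment ((cyclic_perm ^^ k) q)"

definition regular_circles :: "(real^3) set set" where
  "regular_circles = (\<lambda>k. shapes_with (regular_wrt k)) ` {0, 1, 2}"

definition regular_shapes :: "(real^3) set" where
  "regular_shapes = \<Union> regular_circles"

section \<open>Arc length\<close>

definition circle_param :: "(real^3) \<times> (real^3) \<Rightarrow> real \<Rightarrow> real^3" where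
  "circle_param uv t = cos t *\<^sub>R fst uv + sin t *\<^sub>R snd uv"

text \<open>For a great circle \<open>C\<close>, its unit-speed parametrizations with period \<open>2 * pi\<close>
  are the maps \<^term>\<open>circle_param uv\<close> with \<open>uv\<close> an orthonormal basis of the plane of \<open>C\<close>.\<close>

definition circle_frame :: "(real^3) set \<Rightarrow> (real^3) \<times> (real^3) \<Rightarrow> bool" where
  "circle_frame C uv \<longleftrightarrow>
     norm (fst uv) = 1 \<and> norm (snd uv) = 1 \<and> fst uv \<bullet> snd uv = 0 \<and>
     C = range (circle_param uv)"

text \<open>Arc length of \<open>A \<inter> C\<close> for a great circle \<open>C\<close>. Any two frames of \<open>C\<close> give
  parametrizations that differ by a shift and possibly a reversal of the parameter,
  so the value does not depend on the choice.\<close>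

definition circle_arc_length :: "(real^3) set \<Rightarrow> (real^3) set \<Rightarrow> real" where
  "circle_arc_length C A =
     measure lebesgue {t \<in> {0..<2*pi}. circle_param (SOME uv. circle_frame C uv) t \<in> A \<inter> C}"

text \<open>Arc length of a subset of the union of the great circles in \<open>CC\<close>: distinct great
  circles meet in two points only, so adding over the circles counts no length twice.\<close>

definition arc_length :: "(real^3) set set \<Rightarrow> (real^3) set \<Rightarrow> real" where
  "arc_length CC A = (\<Sum>C\<in>CC. circle_arc_length C A)"

definition prob_given_regular :: "(triangle \<Rightarrow> bool) \<Rightarrow> real" where
  "prob_given_regular P =
     arc_length regular_circles (shapes_with P \<inter> regular_shapes) /
     arc_length regular_circles regular_shapes"

section \<open>Acute and obtuse triangles\<close>

text \<open>Interior angle at \<open>b\<close> of the triangle with vertices \<open>a\<close>, \<open>b\<close>, \<open>c\<close>.\<close>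

definition angle_at :: "real^2 \<Rightarrow> real^2 \<Rightarrow> real^2 \<Rightarrow> real" where
  "angle_at a b c = arccos (((a - b) \<bullet> (c - b)) / (norm (a - b) * norm (c - b)))"

fun interior_angles :: "triangle \<Rightarrow> real set" where
  "interior_angles (q1, q2, q3) = {angle_at q3 q1 q2, angle_at q1 q2 q3, angle_at q2 q3 q1}"

fun noncollinear :: "triangle \<Rightarrow> bool" where
  "noncollinear (q1, q2, q3) \<longleftrightarrow> \<not> collinear {q1, q2, q3}"

definition acute :: "triangle \<Rightarrow> bool" where
  "acute q \<longleftrightarrow> noncollinear q \<and> (\<forall>\<theta>\<in>interior_angles q. \<theta> < pi / 2)"

definition obtuse :: "triangle \<Rightarrow> bool" where
  "obtuse q \<longleftrightarrow> noncollinear q \<and> (\<exists>\<theta>\<in>interior_angles q. \<theta> > pi / 2)"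

end

theory Submission
  imports Defs
begin

text \<open>
  On the shape sphere the squared side lengths are affine functions. If \<open>I\<close> is the moment of
  inertia, the side opposite vertex \<open>k + 1\<close> has squared length \<open>I * (1 + height k p)\<close>, where
  \<open>height k p\<close> is the signed distance of \<open>p\<close> from a plane through the centre, and the three
  planes arise from one another by rotation through \<open>2 * pi / 3\<close> about the second axis
  (\<open>side_sq\<close>). Since the three heights sum to zero, the law of cosines turns
  ``the angle at vertex \<open>k + 1\<close> is less than \<open>pi / 2\<close>'' into \<open>height k p < 1/2\<close>
  (\<open>acute_iff\<close>, \<open>obtuse_iff\<close>), and regularity for labelling \<open>k\<close> into \<open>height k p = 0\<close>
  (\<open>regular_iff\<close>). So each set of regular shapes is a great circle, and it passes through the two
  poles \<open>(0, \<plusminus>1, 0)\<close>.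

  On that circle let \<open>w\<close> be the cosine of the angular distance from one of its two collinear shapes.
  The other two heights are \<open>\<plusminus> sqrt 3 / 2 * w\<close>, so the shape is acute iff \<open>\<bar>w\<bar> < 1 / sqrt 3\<close>,
  and obtuse iff \<open>1 / sqrt 3 < \<bar>w\<bar> < 1\<close>, the value \<open>\<bar>w\<bar> = 1\<close> belonging to the collinear
  shapes (\<open>acute_obtuse_on_regular_circle\<close>).

  In every unit-speed parametrization of the circle \<open>w = cos (t - a)\<close> for some phase \<open>a\<close>
  (\<open>inner_circle_param\<close>), which is why the choice of frame in the arc length is
  immaterial: by periodicity the measure of the parameters with \<open>\<bar>cos (t - a)\<bar> < c\<close> is
  \<open>4 * arcsin c\<close> for every \<open>a\<close> (\<open>measure_abs_cos_less\<close>). All circles contribute equally, so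
  the probability is the proportion on any one of them, \<open>4 * arcsin (1 / sqrt 3) / (2 * pi)\<close>.
\<close>

section \<open>Coordinates and the Hopf map\<close>

definition inertia :: "triangle \<Rightarrow> real" where
  "inertia q = (norm (rho1 q))\<^sup>2 + (norm (rho2 q))\<^sup>2"

text \<open>
  Signed distance from the plane of the great circle of shapes that are regular for labelling \<open>k\<close>.
\<close>

definition height :: "nat \<Rightarrow> real^3 \<Rightarrow> real" where
  "height k p = p$3 * cos (2 * pi * k / 3) - p$1 * sin (2 * pi * k / 3)"

lemma cos_sin_thirds:
  "cos (2 * pi / 3) = - 1/2" "sin (2 * pi / 3) = sqrt 3 / 2"
  "cos (4 * pi / 3) = - 1/2" "sin (4 * pi / 3) = - sqrt 3 / 2"
proof -
  have "2 * pi / 3 = pi - pi / 3" "4 * pi / 3 = pi + pi / 3" by simp_all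
  then show "cos (2 * pi / 3) = - 1/2" "sin (2 * pi / 3) = sqrt 3 / 2"
    "cos (4 * pi / 3) = - 1/2" "sin (4 * pi / 3) = - sqrt 3 / 2"
    by (simp_all only: cos_pi_minus sin_pi_minus cos_add sin_add) (simp_all add: cos_60 sin_60)
qed

lemma height_simps:
  "height 0 p = p$3"
  "height (Suc 0) p = - (p$3 + sqrt 3 * p$1) / 2"
  "height 2 p = - (p$3 - sqrt 3 * p$1) / 2"
  using cos_sin_thirds by (simp_all add: height_def)

lemma norm_rho1_sq: "(norm (rho1 q))\<^sup>2 = (norm (jacobi1 q))\<^sup>2 / 2"
  by (simp add: rho1_def power_mult_distrib)

lemma norm_rho2_sq: "(norm (rho2 q))\<^sup>2 = 2/3 * (norm (jacobi2 q))\<^sup>2"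
  by (simp add: rho2_def power_mult_distrib real_sqrt_pow2)

lemma sqrt_half_two_thirds: "sqrt (1/2) * sqrt (2/3) = 1 / sqrt 3"
  by (simp add: real_sqrt_mult[symmetric] real_sqrt_divide)

lemma inner_rho: "rho1 q \<bullet> rho2 q = (jacobi1 q \<bullet> jacobi2 q) / sqrt 3"
proof -
  have "rho1 q \<bullet> rho2 q = (sqrt (1/2) * sqrt (2/3)) * (jacobi1 q \<bullet> jacobi2 q)"
    unfolding rho1_def rho2_def inner_scaleR_left inner_scaleR_right by simp
  then show ?thesis by (simp only: sqrt_half_two_thirds) simp
qed

lemma cross_rho: "cross2 (rho1 q) (rho2 q) = cross2 (jacobi1 q) (jacobi2 q) / sqrt 3"
proof -
  have "cross2 (rho1 q) (rho2 q) = (sqrt (1/2) * sqrt (2/3)) * cross2 (jacobi1 q) (jacobi2 q)"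
    unfolding rho1_def rho2_def cross2_def by (simp add: algebra_simps)
  then show ?thesis by (simp only: sqrt_half_two_thirds) simp
qed

lemma norm_sq_2: "(norm (v :: real^2))\<^sup>2 = (v$1)\<^sup>2 + (v$2)\<^sup>2"
  by (simp add: norm_vec_def L2_set_def sum_2 add_nonneg_nonneg)

lemma norm_sq_3: "(norm (v :: real^3))\<^sup>2 = (v$1)\<^sup>2 + (v$2)\<^sup>2 + (v$3)\<^sup>2"
  by (simp add: norm_vec_def L2_set_def sum_3 add_nonneg_nonneg)

lemma inner_2: "(v :: real^2) \<bullet> w = v$1 * w$1 + v$2 * w$2"
  by (simp add: inner_vec_def sum_2)

lemma inner_3: "(v :: real^3) \<bullet> w = v$1 * w$1 + v$2 * w$2 + v$3 * w$3"
  by (simp add: inner_vec_def sum_3)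

lemma inertia_pos:
  assumes "q \<in> labelled_triangles" shows "inertia q > 0"
proof -
  obtain a b c where q: "q = (a, b, c)" by (cases q)
  have "\<not> (jacobi1 q = 0 \<and> jacobi2 q = 0)"
  proof
    assume "jacobi1 q = 0 \<and> jacobi2 q = 0"
    then have "b = c" "a = (1/2) *\<^sub>R (c + c)" by (simp_all add: q)
    moreover have "(1/2) *\<^sub>R (c + c) = c" by (simp add: vec_eq_iff)
    ultimately show False using assms by (simp add: q labelled_triangles_def)
  qed
  then have "rho1 q \<noteq> 0 \<or> rho2 q \<noteq> 0" by (simp add: rho1_def rho2_def)
  then show ?thesis unfolding inertia_def
    by (metis add_nonneg_pos add_pos_nonneg zero_le_power2 zero_less_norm_iff zero_less_power)
qed

text \<open>
  Lagrange's identity in the plane: it puts the image of the Hopf map on the unit sphere and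
  detects collinearity by the vanishing of the cross product.
\<close>

lemma lagrange_2: "(v \<bullet> w)\<^sup>2 + (cross2 v w)\<^sup>2 = (norm v)\<^sup>2 * (norm w)\<^sup>2"
  unfolding inner_2 cross2_def norm_sq_2 by algebra

lemma hopf_point_simps:
  "hopf_point q $ 1 = 2 * (rho1 q \<bullet> rho2 q) / inertia q"
  "hopf_point q $ 2 = 2 * cross2 (rho1 q) (rho2 q) / inertia q"
  "hopf_point q $ 3 = ((norm (rho1 q))\<^sup>2 - (norm (rho2 q))\<^sup>2) / inertia q"
  by (simp_all add: hopf_point_def inertia_def)

lemma norm_hopf_point:
  assumes "q \<in> labelled_triangles" shows "norm (hopf_point q) = 1"
proof -
  let ?d = "rho1 q \<bullet> rho2 q" and ?c = "cross2 (rho1 q) (rho2 q)"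
  have "(2 * ?d)\<^sup>2 + (2 * ?c)\<^sup>2 + ((norm (rho1 q))\<^sup>2 - (norm (rho2 q))\<^sup>2)\<^sup>2 = (inertia q)\<^sup>2"
    using lagrange_2[of "rho1 q" "rho2 q"] unfolding inertia_def by algebra
  moreover have "(norm (hopf_point q))\<^sup>2 =
     ((2 * ?d)\<^sup>2 + (2 * ?c)\<^sup>2 + ((norm (rho1 q))\<^sup>2 - (norm (rho2 q))\<^sup>2)\<^sup>2) / (inertia q)\<^sup>2"
    unfolding norm_sq_3 hopf_point_simps by (simp add: power_divide add_divide_distrib)
  ultimately have "(norm (hopf_point q))\<^sup>2 = 1" using inertia_pos[OF assms] by simp
  then show ?thesis by (metis norm_ge_zero one_power2 power2_eq_imp_eq zero_le_one)
qed

text \<open>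
  A similarity with ratio \<open>c\<close> multiplies inner product, cross product and moments alike by
  \<open>c\<^sup>2\<close>; only the cross product needs the determinant to be \<open>1\<close>, not just \<open>\<plusminus>1\<close>.
\<close>

lemma hopf_point_similar:
  assumes "(q, p) \<in> same_shape" shows "hopf_point p = hopf_point q"
proof -
  obtain q1 q2 q3 p1 p2 p3 where q: "q = (q1, q2, q3)" and p: "p = (p1, p2, p3)"
    by (cases q, cases p)
  obtain c :: real and A :: "real^2^2" and t where c: "c > 0" and A: "rotation_matrix A"
    and p': "p1 = c *\<^sub>R (A *v q1) + t" "p2 = c *\<^sub>R (A *v q2) + t" "p3 = c *\<^sub>R (A *v q3) + t"
    using assms unfolding same_shape_def q p by blast
  have "orthogonal_transformation ((*v) A)"
    using A by (simp add: orthogonal_transformation_matrix rotation_matrix_def)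
  then have norm: "norm (A *v x) = norm x" and inner: "(A *v x) \<bullet> (A *v y) = x \<bullet> y" for x y
    by (auto simp: orthogonal_transformation_def orthogonal_transformation_norm)
  have cross: "cross2 (A *v x) (A *v y) = cross2 x y" for x y
  proof -
    have "cross2 (A *v x) (A *v y) = det A * cross2 x y"
      by (simp add: cross2_def det_2 matrix_vector_mult_def sum_2 algebra_simps)
    then show ?thesis using A by (simp add: rotation_matrix_def)
  qed
  have j1: "jacobi1 p = c *\<^sub>R (A *v jacobi1 q)"
    by (simp add: p q p' matrix_vector_mult_diff_distrib scaleR_diff_right)
  have "(1/2) *\<^sub>R (t + t) = t" by (simp add: vec_eq_iff)
  then have j2: "jacobi2 p = c *\<^sub>R (A *v jacobi2 q)"
    by (simp add: p q p' matrix_vector_mult_diff_distrib matrix_vector_right_distrib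
        matrix_vector_mult_scaleR scaleR_add_right algebra_simps)
  have r1: "rho1 p = c *\<^sub>R (A *v rho1 q)" and r2: "rho2 p = c *\<^sub>R (A *v rho2 q)"
    unfolding rho1_def rho2_def j1 j2 by (simp_all add: matrix_vector_mult_scaleR)
  have scaled: "rho1 p \<bullet> rho2 p = c\<^sup>2 * (rho1 q \<bullet> rho2 q)"
    "cross2 (rho1 p) (rho2 p) = c\<^sup>2 * cross2 (rho1 q) (rho2 q)"
    "(norm (rho1 p))\<^sup>2 = c\<^sup>2 * (norm (rho1 q))\<^sup>2" "(norm (rho2 p))\<^sup>2 = c\<^sup>2 * (norm (rho2 q))\<^sup>2"
  proof -
    have "cross2 (c *\<^sub>R x) (c *\<^sub>R y) = c\<^sup>2 * cross2 x y" for x y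
      by (simp add: cross2_def power2_eq_square algebra_simps)
    then show "cross2 (rho1 p) (rho2 p) = c\<^sup>2 * cross2 (rho1 q) (rho2 q)"
      unfolding r1 r2 by (simp add: cross)
  qed (simp_all add: r1 r2 norm inner power_mult_distrib power2_eq_square)
  have s: "inertia p = c\<^sup>2 * inertia q"
    unfolding inertia_def scaled by (simp add: distrib_left)
  have "hopf_point p $ 1 = hopf_point q $ 1" "hopf_point p $ 2 = hopf_point q $ 2"
    "hopf_point p $ 3 = hopf_point q $ 3"
    unfolding hopf_point_simps s scaled right_diff_distrib[symmetric] using c by simp_all
  then show ?thesis by (simp add: vec_eq_iff forall_3)
qed

section \<open>Properties of shapes as subsets of the sphere\<close>

lemma same_shape_refl:
  assumes "q \<in> labelled_triangles" shows "(q, q) \<in> same_shape"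
proof -
  obtain a b c where q: "q = (a, b, c)" by (cases q)
  have "rotation_matrix (mat 1 :: real^2^2)"
    by (simp add: rotation_matrix_def orthogonal_matrix_id)
  then have "\<exists>(s::real) (A::real^2^2) t. s > 0 \<and> rotation_matrix A \<and>
     a = s *\<^sub>R (A *v a) + t \<and> b = s *\<^sub>R (A *v b) + t \<and> c = s *\<^sub>R (A *v c) + t"
    by (intro exI[of _ 1] exI[of _ "mat 1"] exI[of _ 0]) simp
  then show ?thesis using assms unfolding same_shape_def q by blast
qed

text \<open>
  Passing to the quotient changes nothing, because every class contains the triangle that it is
  the class of and the Hopf map is constant on it.
\<close>

lemma shapes_with_eq: "shapes_with P = hopf_point ` {q \<in> labelled_triangles. P q}"
proof -
  have *: "sphere_point (same_shape `` {q}) = hopf_point q" if "q \<in> labelled_triangles" for q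
  proof -
    have "hopf_point ` (same_shape `` {q}) = {hopf_point q}"
    proof (rule subset_antisym)
      show "hopf_point ` (same_shape `` {q}) \<subseteq> {hopf_point q}"
        by (auto dest: hopf_point_similar)
      show "{hopf_point q} \<subseteq> hopf_point ` (same_shape `` {q})"
        using same_shape_refl[OF that] by blast
    qed
    then show ?thesis by (simp add: sphere_point_def)
  qed
  show ?thesis
  proof (intro subset_antisym subsetI)
    fix x assume "x \<in> shapes_with P"
    then obtain q p where "q \<in> labelled_triangles" "(q, p) \<in> same_shape" "P p"
      "x = sphere_point (same_shape `` {q})"
      by (auto simp: shapes_with_def shapes_def quotient_def)
    moreover from this have "p \<in> labelled_triangles" by (auto simp: same_shape_def)
    ultimately show "x \<in> hopf_point ` {q \<in> labelled_triangles. P q}"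
      using * hopf_point_similar by (metis (mono_tags, lifting) imageI mem_Collect_eq)
  next
    fix x assume "x \<in> hopf_point ` {q \<in> labelled_triangles. P q}"
    then obtain q where q: "q \<in> labelled_triangles" "P q" "x = hopf_point q" by blast
    then have "same_shape `` {q} \<in> shapes" "q \<in> same_shape `` {q}"
      by (auto simp: shapes_def quotient_def same_shape_refl)
    then show "x \<in> shapes_with P"
      unfolding shapes_with_def using q * by (metis (mono_tags, lifting) imageI mem_Collect_eq)
  qed
qed

text \<open>
  Identifying the plane with the complex numbers, \<open>X + i Y\<close> is \<open>2 * cnj \<rho>\<^sub>1 * \<rho>\<^sub>2 / I\<close>; taking \<open>\<rho>\<^sub>1\<close> real
  and proportional to \<open>1 + Z\<close> gives \<open>\<rho>\<^sub>2\<close> proportional to \<open>X + i Y\<close>. This choice degenerates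
  only at \<open>Z = -1\<close>, where \<open>\<rho>\<^sub>1 = 0\<close>.
\<close>

lemma hopf_point_surj:
  assumes "norm p = 1" obtains q where "q \<in> labelled_triangles" "hopf_point q = p"
proof -
  have p: "(p$1)\<^sup>2 + (p$2)\<^sup>2 + (p$3)\<^sup>2 = 1" using assms norm_sq_3[of p] by simp
  define r1 r2 :: "real^2" where "r1 = (if p$3 = -1 then 0 else vector [1 + p$3, 0])"
    and "r2 = (if p$3 = -1 then vector [1, 0] else vector [p$1, p$2])"
  define w where "w = sqrt 2 *\<^sub>R r1"
  define q :: triangle where
    "q = (sqrt (3/2) *\<^sub>R r2, - (1/2) *\<^sub>R w, (1/2) *\<^sub>R w)"
  have j: "jacobi1 q = w" "jacobi2 q = sqrt (3/2) *\<^sub>R r2"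
    by (simp_all add: q_def scaleR_left_distrib[symmetric])
  have "sqrt (1/2) * sqrt 2 = 1" "sqrt (2/3) * sqrt (3/2) = 1"
    by (simp_all add: real_sqrt_mult[symmetric] del: real_sqrt_divide)
  then have r: "rho1 q = r1" "rho2 q = r2"
    unfolding rho1_def rho2_def j w_def by (simp_all del: real_sqrt_divide)
  have nz: "r1 \<noteq> 0 \<or> r2 \<noteq> 0"
    by (auto simp: r1_def r2_def vec_eq_iff forall_2)
  have "q \<in> labelled_triangles"
  proof (rule ccontr)
    assume "q \<notin> labelled_triangles"
    then have eq: "sqrt (3/2) *\<^sub>R r2 = - (1/2) *\<^sub>R w" "- (1/2) *\<^sub>R w = (1/2) *\<^sub>R w"
      by (auto simp: labelled_triangles_def q_def)
    then have "w = 0" by (auto simp: vec_eq_iff)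
    with eq have "r1 = 0" "r2 = 0" by (auto simp: w_def)
    then show False using nz by simp
  qed
  moreover have "hopf_point q = p"
  proof (cases "p$3 = -1")
    case True
    then have "p$1 = 0" "p$2 = 0" using p by (auto simp: add_nonneg_eq_0_iff)
    then show ?thesis using True
      by (simp add: vec_eq_iff forall_3 hopf_point_simps inertia_def r norm_sq_2 r1_def r2_def cross2_def)
  next
    case False
    then have nz2: "2 + 2 * p$3 \<noteq> 0" by simp
    have s: "inertia q = 2 * (1 + p$3)"
      using False p by (simp add: inertia_def r norm_sq_2 r1_def r2_def) algebra
    have d: "(norm r1)\<^sup>2 - (norm r2)\<^sup>2 = p$3 * (2 * (1 + p$3))"
      using False p by (simp add: inertia_def r norm_sq_2 r1_def r2_def) algebra
    show ?thesis
      unfolding vec_eq_iff forall_3 hopf_point_simps s r d using False nz2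
      by (simp add: r1_def r2_def inner_2 cross2_def field_simps)
  qed
  ultimately show ?thesis using that by blast
qed

section \<open>Side lengths, angles and regularity\<close>

text \<open>
  The side opposite \<open>q1\<close> is \<open>R\<^sub>1\<close> and the other two are \<open>R\<^sub>2 \<plusminus> R\<^sub>1 / 2\<close> up to sign, so all three squares
  are linear in the squared norms of \<open>R\<^sub>1\<close>, \<open>R\<^sub>2\<close> and in their inner product, that is, in \<open>I\<close>,
  \<open>I * Z\<close> and \<open>I * X\<close>.
\<close>

lemma side_sq:
  assumes "(q1, q2, q3) \<in> labelled_triangles"
  defines "I \<equiv> inertia (q1, q2, q3)" and "p \<equiv> hopf_point (q1, q2, q3)"
  shows "(norm (q3 - q2))\<^sup>2 = I * (1 + height 0 p)"
    and "(norm (q1 - q3))\<^sup>2 = I * (1 + height 1 p)"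
    and "(norm (q2 - q1))\<^sup>2 = I * (1 + height 2 p)"
proof -
  let ?q = "(q1, q2, q3)"
  have I: "I > 0" unfolding I_def by (rule inertia_pos[OF assms(1)])
  have Ieq: "I = (norm (jacobi1 ?q))\<^sup>2 / 2 + 2/3 * (norm (jacobi2 ?q))\<^sup>2"
    unfolding I_def inertia_def norm_rho1_sq norm_rho2_sq by simp
  have X: "I * (sqrt 3 * p$1) = 2 * (jacobi1 ?q \<bullet> jacobi2 ?q)"
    and Z: "I * p$3 = (norm (jacobi1 ?q))\<^sup>2 / 2 - 2/3 * (norm (jacobi2 ?q))\<^sup>2"
    using I unfolding p_def hopf_point_simps I_def[symmetric] inner_rho norm_rho1_sq norm_rho2_sq
    by simp_all
  show "(norm (q3 - q2))\<^sup>2 = I * (1 + height 0 p)"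
    using Ieq Z unfolding height_simps distrib_left by simp
  have h: "I * (1 + height 1 p) = I - I * p$3 / 2 - I * (sqrt 3 * p$1) / 2"
    "I * (1 + height 2 p) = I - I * p$3 / 2 + I * (sqrt 3 * p$1) / 2"
    by (simp_all add: height_simps field_simps)
  show "(norm (q1 - q3))\<^sup>2 = I * (1 + height 1 p)" "(norm (q2 - q1))\<^sup>2 = I * (1 + height 2 p)"
    unfolding h X Z unfolding Ieq norm_sq_2 inner_2
    by (simp_all add: power2_eq_square field_simps)
qed

text \<open>
  If the vertex \<open>b\<close> coincides with \<open>a\<close> or \<open>c\<close>, both sides of each equivalence are false, since then the quotient
  defining the angle is \<open>0\<close> and the angle is \<open>pi/2\<close>.
\<close>

lemma angle_at_less: "angle_at a b c < pi/2 \<longleftrightarrow> (a - b) \<bullet> (c - b) > 0"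
  and angle_at_greater: "angle_at a b c > pi/2 \<longleftrightarrow> (a - b) \<bullet> (c - b) < 0"
proof -
  let ?x = "((a - b) \<bullet> (c - b)) / (norm (a - b) * norm (c - b))"
  have "\<bar>?x\<bar> \<le> 1"
  proof (cases "a = b \<or> c = b")
    case False
    then have "0 < norm (a - b) * norm (c - b)" by simp
    then show ?thesis
      using Cauchy_Schwarz_ineq2[of "a - b" "c - b"] by (simp add: divide_le_eq_1_pos abs_mult)
  qed auto
  then have "arccos ?x < arccos 0 \<longleftrightarrow> 0 < ?x" "arccos 0 < arccos ?x \<longleftrightarrow> ?x < 0"
    using arccos_less_mono[of ?x 0] arccos_less_mono[of 0 ?x] by auto
  moreover have "0 < ?x \<longleftrightarrow> (a - b) \<bullet> (c - b) > 0" "?x < 0 \<longleftrightarrow> (a - b) \<bullet> (c - b) < 0"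
    by (auto simp: zero_less_divide_iff divide_less_0_iff zero_less_mult_iff mult_less_0_iff)
  ultimately show "angle_at a b c < pi/2 \<longleftrightarrow> (a - b) \<bullet> (c - b) > 0"
    "angle_at a b c > pi/2 \<longleftrightarrow> (a - b) \<bullet> (c - b) < 0"
    by (simp_all add: angle_at_def)
qed

lemma cosine_rule:
  fixes a b c :: "'a::real_inner"
  shows "2 * ((a - b) \<bullet> (c - b)) = (norm (a - b))\<^sup>2 + (norm (c - b))\<^sup>2 - (norm (a - c))\<^sup>2"
  by (simp add: power2_norm_eq_inner inner_diff_left inner_diff_right inner_commute algebra_simps)

lemma noncollinear_iff:
  assumes "q \<in> labelled_triangles"
  shows "noncollinear q \<longleftrightarrow> hopf_point q $ 2 \<noteq> 0"
proof -
  obtain a b c where q: "q = (a, b, c)" by (cases q)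
  let ?v = "c - b" and ?w = "a - b"
  have "collinear {a, b, c} \<longleftrightarrow> collinear {0, ?v, ?w}"
    using collinear_3[of c b a] by (simp add: insert_commute)
  also have "\<dots> \<longleftrightarrow> \<bar>?v \<bullet> ?w\<bar> = norm ?v * norm ?w"
    by (simp add: norm_cauchy_schwarz_equal)
  also have "\<dots> \<longleftrightarrow> (?v \<bullet> ?w)\<^sup>2 = (norm ?v * norm ?w)\<^sup>2"
    using power2_eq_iff_nonneg[of "\<bar>?v \<bullet> ?w\<bar>" "norm ?v * norm ?w"] by simp
  also have "\<dots> \<longleftrightarrow> cross2 ?v ?w = 0"
    using lagrange_2[of ?v ?w] by (auto simp: power_mult_distrib)
  also have "cross2 ?v ?w = cross2 (jacobi1 q) (jacobi2 q)"
    by (simp add: q cross2_def field_simps)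
  finally show ?thesis
    using inertia_pos[OF assms] by (simp add: q hopf_point_simps cross_rho)
qed

text \<open>
  With squared sides \<open>I * (1 + h\<^sub>k)\<close> and \<open>h\<^sub>0 + h\<^sub>1 + h\<^sub>2 = 0\<close>, the law of cosines gives
  \<open>I * (1/2 - h\<^sub>k)\<close> for the inner product of the sides at vertex \<open>k + 1\<close>.
\<close>

lemma
  assumes "q \<in> labelled_triangles"
  shows acute_iff:
    "acute q \<longleftrightarrow> hopf_point q $ 2 \<noteq> 0 \<and> (\<forall>k\<in>{0,1,2}. height k (hopf_point q) < 1/2)" (is ?A)
  and obtuse_iff:
    "obtuse q \<longleftrightarrow> hopf_point q $ 2 \<noteq> 0 \<and> (\<exists>k\<in>{0,1,2}. height k (hopf_point q) > 1/2)" (is ?O)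
proof -
  obtain a b c where q: "q = (a, b, c)" by (cases q)
  let ?I = "inertia q" and ?p = "hopf_point q"
  have I: "?I > 0" by (rule inertia_pos[OF assms])
  note s = side_sq[OF assms[unfolded q], folded q]
  have sum: "height 0 ?p + height 1 ?p + height 2 ?p = 0" by (simp add: height_simps field_simps)
  have h: "height 2 ?p = - height 0 ?p - height 1 ?p" using sum by simp
  have i: "(c - a) \<bullet> (b - a) = ?I * (1/2 - height 0 ?p)"
     "(a - b) \<bullet> (c - b) = ?I * (1/2 - height 1 ?p)"
     "(b - c) \<bullet> (a - c) = ?I * (1/2 - height 2 ?p)"
    using cosine_rule[of c a b] cosine_rule[of a b c] cosine_rule[of b c a] s
    unfolding h by (simp_all add: norm_minus_commute algebra_simps)
  show ?A unfolding acute_def noncollinear_iff[OF assms] unfolding q interior_angles.simps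
    unfolding q[symmetric]
    by (simp only: ball_simps angle_at_less i) (use I in \<open>auto simp: zero_less_mult_iff\<close>)
  show ?O unfolding obtuse_def noncollinear_iff[OF assms] unfolding q interior_angles.simps
    unfolding q[symmetric]
    by (simp only: bex_simps angle_at_greater i) (use I in \<open>auto simp: mult_less_0_iff\<close>)
qed

text \<open>
  The moment of inertia does not depend on the labelling, so regularity says that the base moment,
  half the squared base, is \<open>I / 2\<close>.
\<close>

lemma regular_iff:
  assumes "q \<in> labelled_triangles" "k \<in> {0, 1, 2}"
  shows "regular_wrt k q \<longleftrightarrow> height k (hopf_point q) = 0"
proof -
  obtain a b c where q: "q = (a, b, c)" by (cases q)
  let ?I = "inertia q" and ?p = "hopf_point q"
  have I: "?I > 0" by (rule inertia_pos[OF assms(1)])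
  note s = side_sq[OF assms(1)[unfolded q], folded q]
  have inv: "inertia (cyclic_perm r) = inertia r" for r
    unfolding inertia_def norm_rho1_sq norm_rho2_sq unfolding norm_sq_2
    by (cases r) (simp add: power2_eq_square field_simps)
  have "inertia ((cyclic_perm ^^ k) q) = ?I" by (induction k) (simp_all add: inv)
  moreover have "base_moment ((cyclic_perm ^^ k) q) = ?I * (1 + height k ?p) / 2"
    using assms(2) s unfolding base_moment_def norm_rho1_sq
    by (auto simp: q numeral_2_eq_2)
  ultimately have "regular_wrt k q \<longleftrightarrow> ?I * (1 + height k ?p) / 2 = ?I - ?I * (1 + height k ?p) / 2"
    unfolding regular_wrt_def inertia_def base_moment_def median_moment_def by linarith
  also have "\<dots> \<longleftrightarrow> height k ?p = 0" using I by (simp add: field_simps)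
  finally show ?thesis .
qed

lemma shapes_with_sphere:
  assumes "\<And>q. q \<in> labelled_triangles \<Longrightarrow> P q \<longleftrightarrow> Q (hopf_point q)"
  shows "shapes_with P = {p. norm p = 1 \<and> Q p}"
  unfolding shapes_with_eq using assms norm_hopf_point by (auto elim: hopf_point_surj)

lemma shapes_with_acute:
  "shapes_with acute = {p. norm p = 1 \<and> p$2 \<noteq> 0 \<and> (\<forall>k\<in>{0,1,2}. height k p < 1/2)}"
  by (rule shapes_with_sphere) (rule acute_iff)

lemma shapes_with_obtuse:
  "shapes_with obtuse = {p. norm p = 1 \<and> p$2 \<noteq> 0 \<and> (\<exists>k\<in>{0,1,2}. height k p > 1/2)}"
  by (rule shapes_with_sphere) (rule obtuse_iff)

section \<open>The regular great circles\<close>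

definition regular_circle :: "nat \<Rightarrow> (real^3) set" where
  "regular_circle k = {p. norm p = 1 \<and> height k p = 0}"

text \<open>
  The circle meets the equator of collinear shapes in this point and its antipode.
\<close>

definition collinear_point :: "nat \<Rightarrow> real^3" where
  "collinear_point k = vector [cos (2 * pi * k / 3), 0, sin (2 * pi * k / 3)]"

text \<open>
  The normal of the plane of the circle, the collinear point and the second axis are an
  orthonormal basis.
\<close>

lemma sq_on_regular_circle:
  assumes "p \<in> regular_circle k"
  shows "(p$2)\<^sup>2 + (collinear_point k \<bullet> p)\<^sup>2 = 1"
proof -
  let ?c = "cos (2 * pi * k / 3)" and ?s = "sin (2 * pi * k / 3)"
  have n: "(p$1)\<^sup>2 + (p$2)\<^sup>2 + (p$3)\<^sup>2 = 1" and h: "p$3 * ?c - p$1 * ?s = 0"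
    using assms norm_sq_3[of p] by (simp_all add: regular_circle_def height_def)
  have "(collinear_point k \<bullet> p)\<^sup>2 = (?c * p$1 + ?s * p$3)\<^sup>2"
    by (simp add: inner_3 collinear_point_def)
  also have "\<dots> = (?s\<^sup>2 + ?c\<^sup>2) * ((p$1)\<^sup>2 + (p$3)\<^sup>2) - (p$3 * ?c - p$1 * ?s)\<^sup>2"
    by algebra
  also have "\<dots> = (p$1)\<^sup>2 + (p$3)\<^sup>2" unfolding h by simp
  finally show ?thesis using n by simp
qed

lemma norm_1_3: "norm (p :: real^3) = 1 \<longleftrightarrow> (p$1)\<^sup>2 + (p$2)\<^sup>2 + (p$3)\<^sup>2 = 1"
  unfolding norm_sq_3[symmetric]
  by (metis norm_ge_zero one_power2 power2_eq_imp_eq zero_le_one)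

lemma collinear_point_in_circle: "collinear_point k \<in> regular_circle k"
  by (simp add: regular_circle_def norm_1_3 height_def collinear_point_def)

lemma circle_frame_regular_circle:
  "circle_frame (regular_circle k) (collinear_point k, vector [0, 1, 0])"
proof -
  let ?c = "cos (2 * pi * k / 3)" and ?s = "sin (2 * pi * k / 3)"
  let ?v = "vector [0, 1, 0] :: real^3"
  have "norm (circle_param (collinear_point k, ?v) t) = 1" for t
  proof -
    have "(cos t * ?c)\<^sup>2 + (sin t)\<^sup>2 + (cos t * ?s)\<^sup>2
        = (sin t)\<^sup>2 + (cos t)\<^sup>2 * (?s\<^sup>2 + ?c\<^sup>2)" by algebra
    then show ?thesis
      by (simp add: circle_param_def norm_1_3 collinear_point_def)
  qed
  then have "range (circle_param (collinear_point k, ?v)) \<subseteq> regular_circle k"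
    by (auto simp: regular_circle_def circle_param_def collinear_point_def height_def)
  moreover have "p \<in> range (circle_param (collinear_point k, ?v))" if p: "p \<in> regular_circle k" for p
  proof -
    have "(collinear_point k \<bullet> p)\<^sup>2 + (p$2)\<^sup>2 = 1" using sq_on_regular_circle[OF p] by simp
    then obtain t where t: "collinear_point k \<bullet> p = cos t" "p$2 = sin t"
      using sincos_total_2pi by metis
    have h: "p$3 * ?c - p$1 * ?s = 0" using p by (simp add: regular_circle_def height_def)
    have w: "cos t = ?c * p$1 + ?s * p$3" using t(1) by (simp add: inner_3 collinear_point_def)
    have one: "?s\<^sup>2 + ?c\<^sup>2 = 1" by simp
    have "p$1 = cos t * ?c" "p$3 = cos t * ?s" unfolding w using h one by algebra+
    then have "p = circle_param (collinear_point k, ?v) t"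
      using t(2) by (simp add: vec_eq_iff forall_3 circle_param_def collinear_point_def)
    then show ?thesis by blast
  qed
  ultimately show ?thesis
    using collinear_point_in_circle[of k]
    by (auto simp: circle_frame_def regular_circle_def norm_1_3 inner_3 collinear_point_def)
qed

lemma inner_circle_param:
  assumes "circle_frame C uv"
  shows "circle_param uv s \<bullet> circle_param uv t = cos (t - s)"
proof -
  have "fst uv \<bullet> fst uv = 1" "snd uv \<bullet> snd uv = 1" "fst uv \<bullet> snd uv = 0" "snd uv \<bullet> fst uv = 0"
    using assms by (auto simp: circle_frame_def norm_eq_1 inner_commute)
  then show ?thesis
    by (simp add: circle_param_def inner_add_left inner_add_right cos_diff)
qed

text \<open>
  In the plane spanned by the normals, the other two normals make the angles \<open>\<plusminus> 2 * pi / 3\<close> with the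
  \<open>k\<close>-th one, so they have components \<open>\<plusminus> sqrt 3 / 2\<close> along the collinear point.
\<close>

lemma heights_on_regular_circle:
  assumes "k \<in> {0, 1, 2}" "p \<in> regular_circle k"
  defines "w \<equiv> collinear_point k \<bullet> p"
  shows "(\<lambda>j. height j p) ` {0, 1, 2} = {0, sqrt 3 / 2 * w, - (sqrt 3 / 2 * w)}"
proof -
  have h: "height k p = 0" using assms by (simp add: regular_circle_def)
  consider "k = 0" | "k = 1" | "k = 2" using assms by blast
  then show ?thesis
  proof cases
    case 1
    then show ?thesis using h
      by (auto simp: height_simps w_def collinear_point_def inner_3)
  next
    case 2
    then have p: "p$3 = - (sqrt 3 * p$1)" using h by (simp add: height_simps)
    have "w = - 2 * p$1"
    proof -
      have "w = cos (2 * pi / 3) * p$1 + sin (2 * pi / 3) * p$3"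
        by (simp add: w_def 2 collinear_point_def inner_3)
      then show ?thesis unfolding cos_sin_thirds p by (simp add: mult.assoc[symmetric])
    qed
    then show ?thesis using p by (auto simp: height_simps)
  next
    case 3
    then have p: "p$3 = sqrt 3 * p$1" using h by (simp add: height_simps)
    have "w = - 2 * p$1"
    proof -
      have "w = cos (4 * pi / 3) * p$1 + sin (4 * pi / 3) * p$3"
        by (simp add: w_def 3 collinear_point_def inner_3)
      then show ?thesis unfolding cos_sin_thirds p by (simp add: mult.assoc[symmetric])
    qed
    then show ?thesis using p by (auto simp: height_simps)
  qed
qed

lemma acute_obtuse_on_regular_circle:
  assumes "k \<in> {0, 1, 2}" "p \<in> regular_circle k"
  shows "p \<in> shapes_with acute \<longleftrightarrow> \<bar>collinear_point k \<bullet> p\<bar> < 1 / sqrt 3"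
    and "p \<in> shapes_with obtuse \<longleftrightarrow>
      1 / sqrt 3 < \<bar>collinear_point k \<bullet> p\<bar> \<and> \<bar>collinear_point k \<bullet> p\<bar> < 1"
proof -
  let ?w = "collinear_point k \<bullet> p"
  have n: "norm p = 1" using assms(2) by (simp add: regular_circle_def)
  have "p$2 \<noteq> 0 \<longleftrightarrow> ?w\<^sup>2 < 1"
    using sq_on_regular_circle[OF assms(2)] zero_less_power2[of "p$2"] by linarith
  then have y: "p$2 \<noteq> 0 \<longleftrightarrow> \<bar>?w\<bar> < 1" by (simp add: abs_square_less_1)
  have sc: "\<bar>?w\<bar> < 1 / sqrt 3 \<longleftrightarrow> sqrt 3 / 2 * \<bar>?w\<bar> < 1/2"
    "1 / sqrt 3 < \<bar>?w\<bar> \<longleftrightarrow> 1/2 < sqrt 3 / 2 * \<bar>?w\<bar>"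
    by (simp_all add: field_simps)
  have ab: "sqrt 3 / 2 * \<bar>?w\<bar> = \<bar>sqrt 3 / 2 * ?w\<bar>" by (simp add: abs_mult)
  have less: "(\<forall>j\<in>{0,1,2}. height j p < 1/2) \<longleftrightarrow> (\<forall>x\<in>(\<lambda>j. height j p) ` {0,1,2}. x < 1/2)"
    and gr: "(\<exists>j\<in>{0,1,2}. height j p > 1/2) \<longleftrightarrow> (\<exists>x\<in>(\<lambda>j. height j p) ` {0,1,2}. x > 1/2)"
    by blast+
  have l: "(\<forall>j\<in>{0,1,2}. height j p < 1/2) \<longleftrightarrow> \<bar>?w\<bar> < 1 / sqrt 3"
    unfolding less heights_on_regular_circle[OF assms] sc ab by auto
  have g: "(\<exists>j\<in>{0,1,2}. height j p > 1/2) \<longleftrightarrow> 1 / sqrt 3 < \<bar>?w\<bar>"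
    unfolding gr heights_on_regular_circle[OF assms] sc ab by auto
  have lt: "1 / sqrt 3 < (1::real)" by simp
  show "p \<in> shapes_with acute \<longleftrightarrow> \<bar>?w\<bar> < 1 / sqrt 3"
    unfolding shapes_with_acute mem_Collect_eq y l
    using n lt by (blast intro: less_trans)
  show "p \<in> shapes_with obtuse \<longleftrightarrow> 1 / sqrt 3 < \<bar>?w\<bar> \<and> \<bar>?w\<bar> < 1"
    unfolding shapes_with_obtuse mem_Collect_eq y g
    using n by blast
qed

section \<open>Lengths of parameter sets\<close>

lemma measure_periodic_window:
  fixes S :: "real set"
  assumes S: "S \<in> sets lebesgue" and T: "T > 0" and per: "\<And>x. x + T \<in> S \<longleftrightarrow> x \<in> S"
  shows "measure lebesgue (S \<inter> {a..<a + T}) = measure lebesgue (S \<inter> {0..<T})"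
proof -
  have nat_per: "x + real n * T \<in> S \<longleftrightarrow> x \<in> S" for x n
  proof (induction n)
    case (Suc n)
    then show ?case using per[of "x + real n * T"] by (simp add: algebra_simps)
  qed simp
  have int_per: "x + real_of_int n * T \<in> S \<longleftrightarrow> x \<in> S" for x n
    using nat_per[of x "nat n"] nat_per[of "x + real_of_int n * T" "nat (- n)"]
    by (cases "n \<ge> 0") simp_all
  \<comment> \<open>Cut the window at the multiple \<open>c\<close> of the period that it contains; moving the part before
    \<open>c\<close> behind the other one turns it into a translate of \<open>{0..<T}\<close>.\<close>
  define n where "n = \<lceil>a / T\<rceil>"
  define c where "c = n * T"
  have "a / T \<le> n" "n < a / T + 1" unfolding n_def by linarith+
  then have c: "a \<le> c" "c < a + T" using T unfolding c_def by (simp_all add: field_simps)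
  have shift: "x + c \<in> S \<longleftrightarrow> x \<in> S" for x unfolding c_def by (rule int_per)
  have meas: "S \<inter> {u..<v} \<in> fmeasurable lebesgue" for u v
    by (rule bounded_set_imp_lmeasurable) (use S in \<open>auto intro: bounded_subset[of "{u..v}"]\<close>)
  have split: "measure lebesgue (S \<inter> {u..<w}) =
      measure lebesgue (S \<inter> {u..<v}) + measure lebesgue (S \<inter> {v..<w})"
    if "u \<le> v" "v \<le> w" for u v w
  proof -
    have "S \<inter> {u..<w} = (S \<inter> {u..<v}) \<union> (S \<inter> {v..<w})"
      using that by auto
    moreover have "(S \<inter> {u..<v}) \<inter> (S \<inter> {v..<w}) = {}" by auto
    ultimately show ?thesis
      using measure_Un3[OF meas meas, of u v v w] by simp
  qed
  have 1: "S \<inter> {c..<a + T} = (+) c ` (S \<inter> {0..<a + T - c})"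
  proof (intro subset_antisym subsetI)
    fix x assume "x \<in> S \<inter> {c..<a + T}"
    then show "x \<in> (+) c ` (S \<inter> {0..<a + T - c})"
      using shift[of "x - c"] by (intro image_eqI[of _ _ "x - c"]) auto
  qed (use shift in \<open>auto simp: add.commute\<close>)
  have 2: "S \<inter> {a..<c} = (+) (c - T) ` (S \<inter> {a + T - c..<T})"
  proof (intro subset_antisym subsetI)
    fix x assume "x \<in> S \<inter> {a..<c}"
    then show "x \<in> (+) (c - T) ` (S \<inter> {a + T - c..<T})"
      using shift[of "x - c"] per[of "x - c"]
      by (intro image_eqI[of _ _ "x - (c - T)"]) (auto simp: algebra_simps)
  next
    fix x assume "x \<in> (+) (c - T) ` (S \<inter> {a + T - c..<T})"
    then obtain y where "x = c - T + y" "y \<in> S" "a + T - c \<le> y" "y < T" by auto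
    moreover from this have "c - T + y \<in> S"
      using shift[of "y - T"] per[of "y - T"] by (simp add: algebra_simps)
    ultimately show "x \<in> S \<inter> {a..<c}" by auto
  qed
  have "measure lebesgue (S \<inter> {a..<a + T}) =
      measure lebesgue (S \<inter> {a + T - c..<T}) + measure lebesgue (S \<inter> {0..<a + T - c})"
    using split[of a c "a + T"] c unfolding 1 2 measure_translation by simp
  also have "\<dots> = measure lebesgue (S \<inter> {0..<T})"
    using split[of 0 "a + T - c" T] c by simp
  finally show ?thesis .
qed

text \<open>
  \<open>\<bar>sin\<bar>\<close> has period \<open>pi\<close>, so a full turn consists of two copies of the window around \<open>0\<close>
  on which \<open>sin\<close> is increasing and can be inverted by \<open>arcsin\<close>.
\<close>

lemma measure_abs_cos:
  fixes P :: "real \<Rightarrow> bool"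
  assumes P: "Measurable.pred borel P"
  shows "measure lebesgue {t \<in> {0..<2*pi}. P \<bar>cos (t - a)\<bar>} =
    2 * measure lebesgue {s \<in> {-(pi/2)..<pi/2}. P \<bar>sin s\<bar>}"
proof -
  define S where "S = {s. P \<bar>sin s\<bar>}"
  have "S = {s \<in> space borel. P \<bar>sin s\<bar>}" by (simp add: S_def)
  also have "\<dots> \<in> sets borel" using P by measurable
  finally have S: "S \<in> sets lebesgue" by simp
  have per: "x + pi \<in> S \<longleftrightarrow> x \<in> S" for x by (simp add: S_def)
  have per2: "x + 2 * pi \<in> S \<longleftrightarrow> x \<in> S" for x by (simp add: S_def)
  let ?b = "pi/2 - a"
  have meas: "S \<inter> {u..<v} \<in> fmeasurable lebesgue" for u v
    by (rule bounded_set_imp_lmeasurable) (use S in \<open>auto intro: bounded_subset[of "{u..v}"]\<close>)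
  have "{t \<in> {0..<2*pi}. P \<bar>cos (t - a)\<bar>} = (\<lambda>s. s - ?b) ` (S \<inter> {?b..<?b + 2*pi})"
  proof -
    have "cos (t - a) = sin (t + ?b)" for t
      by (simp add: sin_cos_eq) (metis cos_minus minus_diff_eq)
    then show ?thesis
      by (auto simp: S_def intro!: image_eqI[of _ _ "_ + ?b"])
  qed
  then have "measure lebesgue {t \<in> {0..<2*pi}. P \<bar>cos (t - a)\<bar>} = measure lebesgue (S \<inter> {0..<2*pi})"
    using measure_periodic_window[OF S _ per2, of ?b] by (simp add: measure_translation_subtract)
  also have "\<dots> = measure lebesgue (S \<inter> {0..<pi}) + measure lebesgue (S \<inter> {pi..<pi + pi})"
  proof -
    have "S \<inter> {0..<2*pi} = (S \<inter> {0..<pi}) \<union> (S \<inter> {pi..<pi + pi})" by auto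
    moreover have "(S \<inter> {0..<pi}) \<inter> (S \<inter> {pi..<pi + pi}) = {}" by auto
    ultimately show ?thesis using measure_Un3[OF meas meas, of 0 pi pi "pi + pi"] by simp
  qed
  also have "\<dots> = 2 * measure lebesgue (S \<inter> {-(pi/2)..<-(pi/2) + pi})"
    using measure_periodic_window[OF S pi_gt_zero per, of pi]
      measure_periodic_window[OF S pi_gt_zero per, of "-(pi/2)"] by linarith
  also have "S \<inter> {-(pi/2)..<-(pi/2) + pi} = {s \<in> {-(pi/2)..<pi/2}. P \<bar>sin s\<bar>}"
    by (auto simp: S_def)
  finally show ?thesis .
qed

lemma abs_sin_less_iff:
  assumes "\<bar>s\<bar> \<le> pi/2" "0 \<le> c" "c \<le> 1"
  shows "\<bar>sin s\<bar> < c \<longleftrightarrow> \<bar>s\<bar> < arcsin c"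
    and "c < \<bar>sin s\<bar> \<longleftrightarrow> arcsin c < \<bar>s\<bar>"
proof -
  have "sin \<bar>s\<bar> \<ge> 0" using assms by (intro sin_ge_zero) auto
  then have "\<bar>sin s\<bar> = sin \<bar>s\<bar>" by (auto simp: abs_if split: if_splits)
  moreover have "sin (arcsin c) = c" "\<bar>arcsin c\<bar> \<le> pi/2"
    using assms arcsin_bounded[of c] by auto
  ultimately show "\<bar>sin s\<bar> < c \<longleftrightarrow> \<bar>s\<bar> < arcsin c" "c < \<bar>sin s\<bar> \<longleftrightarrow> arcsin c < \<bar>s\<bar>"
    using sin_mono_less_eq[of "\<bar>s\<bar>" "arcsin c"] sin_mono_less_eq[of "arcsin c" "\<bar>s\<bar>"] assms(1)
    by auto
qed

lemma measure_abs_cos_less: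
  assumes "0 \<le> c" "c \<le> 1"
  shows "measure lebesgue {t \<in> {0..<2*pi}. \<bar>cos (t - a)\<bar> < c} = 4 * arcsin c"
proof -
  have b: "0 \<le> arcsin c" "arcsin c \<le> pi/2"
    using assms arcsin_bounded[of c] arcsin_le_arcsin[of 0 c] by auto
  have "{s \<in> {-(pi/2)..<pi/2}. \<bar>sin s\<bar> < c} = {- arcsin c<..<arcsin c}"
  proof (intro set_eqI)
    fix s
    show "s \<in> {s \<in> {-(pi/2)..<pi/2}. \<bar>sin s\<bar> < c} \<longleftrightarrow> s \<in> {- arcsin c<..<arcsin c}"
      using abs_sin_less_iff(1)[of s c] assms b by (cases "\<bar>s\<bar> \<le> pi/2") auto
  qed
  then show ?thesis using measure_abs_cos[of "\<lambda>x. x < c" a] b by simp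
qed

text \<open>
  Excluding \<open>\<bar>cos\<bar> = 1\<close> removes the two parameters of the collinear shapes; in the half-turn window
  this shows up as open intervals.
\<close>

lemma measure_abs_cos_between:
  assumes "0 \<le> c" "c \<le> 1"
  shows "measure lebesgue {t \<in> {0..<2*pi}. c < \<bar>cos (t - a)\<bar> \<and> \<bar>cos (t - a)\<bar> < 1} = 2 * pi - 4 * arcsin c"
proof -
  have b: "0 \<le> arcsin c" "arcsin c \<le> pi/2"
    using assms arcsin_bounded[of c] arcsin_le_arcsin[of 0 c] by auto
  have "{s \<in> {-(pi/2)..<pi/2}. c < \<bar>sin s\<bar> \<and> \<bar>sin s\<bar> < 1} =
      {-(pi/2)<..<- arcsin c} \<union> {arcsin c<..<pi/2}"
  proof (intro set_eqI)
    fix s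
    show "s \<in> {s \<in> {-(pi/2)..<pi/2}. c < \<bar>sin s\<bar> \<and> \<bar>sin s\<bar> < 1} \<longleftrightarrow>
        s \<in> {-(pi/2)<..<- arcsin c} \<union> {arcsin c<..<pi/2}"
      using abs_sin_less_iff(2)[of s c] abs_sin_less_iff(1)[of s 1] assms b
      by (cases "\<bar>s\<bar> \<le> pi/2") auto
  qed
  moreover have "measure lebesgue ({-(pi/2)<..<- arcsin c} \<union> {arcsin c<..<pi/2}) = pi - 2 * arcsin c"
    proof -
    have "{-(pi/2)<..<- arcsin c} \<inter> {arcsin c<..<pi/2} = {}" using b by auto
    then show ?thesis using b by (subst measure_Un3) auto
  qed
  ultimately show ?thesis using measure_abs_cos[of "\<lambda>x. c < x \<and> x < 1" a] by simp
qed

section \<open>Probabilities\<close>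

lemma regular_circles_eq: "regular_circles = regular_circle ` {0, 1, 2}"
  unfolding regular_circles_def regular_circle_def
  by (intro image_cong refl shapes_with_sphere regular_iff)

text \<open>
  The frame in the arc length is an unspecified one. Its parametrization passes through the
  collinear point at some parameter \<open>a\<close>, and only this phase enters.
\<close>

lemma circle_arc_length_regular_circle:
  assumes "\<And>p. p \<in> regular_circle k \<Longrightarrow> p \<in> A \<longleftrightarrow> P \<bar>collinear_point k \<bullet> p\<bar>"
  obtains a where "circle_arc_length (regular_circle k) A =
    measure lebesgue {t \<in> {0..<2*pi}. P \<bar>cos (t - a)\<bar>}"
proof -
  define uv where "uv = (SOME uv. circle_frame (regular_circle k) uv)"
  have uv: "circle_frame (regular_circle k) uv"
    unfolding uv_def by (rule someI[of _ "(collinear_point k, vector [0, 1, 0])"])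
      (rule circle_frame_regular_circle)
  then have range: "regular_circle k = range (circle_param uv)" by (simp add: circle_frame_def)
  then obtain a where a: "collinear_point k = circle_param uv a"
    using collinear_point_in_circle[of k] by blast
  have "circle_param uv t \<in> A \<inter> regular_circle k \<longleftrightarrow> P \<bar>cos (t - a)\<bar>" for t
  proof -
    have "circle_param uv t \<in> regular_circle k" using range by blast
    then show ?thesis using assms[of "circle_param uv t"] by (simp add: a inner_circle_param[OF uv])
  qed
  then have "circle_arc_length (regular_circle k) A =
      measure lebesgue {t \<in> {0..<2*pi}. P \<bar>cos (t - a)\<bar>}"
    by (simp add: circle_arc_length_def uv_def[symmetric])
  then show ?thesis by (rule that)
qed

text \<open>
  Numerator and denominator are sums of equal terms over the same circles, so the number of circles
  cancels.
\<close>

lemma prob_given_regular_eq: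
  assumes "\<And>k p. k \<in> {0, 1, 2} \<Longrightarrow> p \<in> regular_circle k \<Longrightarrow>
      p \<in> shapes_with E \<longleftrightarrow> P \<bar>collinear_point k \<bullet> p\<bar>"
    and "\<And>a. measure lebesgue {t \<in> {0..<2*pi}. P \<bar>cos (t - a)\<bar>} = L"
  shows "prob_given_regular E = L / (2 * pi)"
proof -
  have sub: "regular_circle k \<subseteq> regular_shapes" if "k \<in> {0, 1, 2}" for k
    unfolding regular_shapes_def regular_circles_eq using that by blast
  have "circle_arc_length C (shapes_with E \<inter> regular_shapes) = L" if C: "C \<in> regular_circles" for C
  proof -
    obtain k where k: "C = regular_circle k" "k \<in> {0, 1, 2}"
      using C unfolding regular_circles_eq by (rule imageE)
    have "p \<in> shapes_with E \<inter> regular_shapes \<longleftrightarrow> P \<bar>collinear_point k \<bullet> p\<bar>"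
      if "p \<in> regular_circle k" for p
      using assms(1)[OF k(2) that] sub[OF k(2)] that by blast
    then obtain a where "circle_arc_length (regular_circle k) (shapes_with E \<inter> regular_shapes) =
        measure lebesgue {t \<in> {0..<2*pi}. P \<bar>cos (t - a)\<bar>}"
      by (rule circle_arc_length_regular_circle[where P = P])
    then show ?thesis unfolding k(1) assms(2) .
  qed
  then have num: "arc_length regular_circles (shapes_with E \<inter> regular_shapes) = card regular_circles * L"
    by (simp add: arc_length_def)
  have "circle_arc_length C regular_shapes = 2 * pi" if C: "C \<in> regular_circles" for C
  proof -
    obtain k where k: "C = regular_circle k" "k \<in> {0, 1, 2}"
      using C unfolding regular_circles_eq by (rule imageE)
    have "p \<in> regular_shapes \<longleftrightarrow> True" if "p \<in> regular_circle k" for p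
      using sub[OF k(2)] that by blast
    then obtain a :: real where "circle_arc_length (regular_circle k) regular_shapes =
        measure lebesgue {t::real \<in> {0..<2*pi}. True}"
      by (rule circle_arc_length_regular_circle[where P = "\<lambda>_. True"])
    moreover have "{t::real \<in> {0..<2*pi}. True} = {0..<2*pi}" by auto
    ultimately show ?thesis unfolding k(1) by (simp only: measure_completion) simp
  qed
  then have den: "arc_length regular_circles regular_shapes = card regular_circles * (2 * pi)"
    by (simp add: arc_length_def)
  have "card regular_circles \<noteq> 0" by (simp add: regular_circles_eq)
  then show ?thesis unfolding prob_given_regular_def num den by simp
qed

theorem mainTheorem3:
  shows "prob_given_regular acute = 2 / pi * arcsin (1 / sqrt 3) \<and>
         prob_given_regular obtuse = (pi - 2 * arcsin (1 / sqrt 3)) / pi"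
proof
  have c: "0 \<le> 1 / sqrt 3" "1 / sqrt 3 \<le> 1" by simp_all
  show "prob_given_regular acute = 2 / pi * arcsin (1 / sqrt 3)"
    using prob_given_regular_eq[OF acute_obtuse_on_regular_circle(1) measure_abs_cos_less[OF c]]
    by simp
  show "prob_given_regular obtuse = (pi - 2 * arcsin (1 / sqrt 3)) / pi"
    using prob_given_regular_eq[OF acute_obtuse_on_regular_circle(2) measure_abs_cos_between[OF c]]
    by (simp add: field_simps)
qed

end
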